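(* Let $X$ be a Banach space which admits an unconditional atomic decomposition $((x'_i),(x_i))$. Then $((x'_i),(x_i))$ is shrinking if and only if $X$ does not contain an isomorphic copy of $\ell_1$.
   Context: $X'$ denotes the topological dual of $X$ and $\langle\cdot,\cdot\rangle$ the duality pairing. A Banach sequence space is a Banach space of scalar sequences indexed by $\mathbb N$ for which the coordinate functionals are continuous. Atomic decomposition: for sequences $(x'_i)\subset X'$ and $(x_i)\subset X$, the pair $((x'_i),(x_i))$ is an atomic decomposition of $X$ with respect to a Banach sequence space $Z$ if there are constants $A,B>0$ such that for all $x\in X$: (a) $(\langle x'_i,x\rangle)_i\in Z$; (b) $A\|x\|\le\|(\langle x'_i,x\rangle)_i\|_Z\le B\|x\|$; (c) $x=\sum_{i=1}^\infty\langle x'_i,x\rangle x_i$. It is an atomic decomposition of $X$ if this holds with respect to some Banach sequence space $Z$; it is unconditional if the series in (c) converges unconditionally for every $x\in X$. Given an atomic decomposition $((x'_i),(x_i))$ of $X$, let $T_N\colon X\to X$ be the bounded linear operators $T_N(x)=\sum_{i\ge N}\langle x'_i,x\rangle x_i$. The atomic decomposition is shrinking if $\|x'\circ T_N\|\to0$ as $N\to\infty$ for every $x'\in X'$. *)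

theory Defs
  imports "HOL-Analysis.Analysis"
begin

text \<open>
  The scalar field is a type of sort \<open>{real_normed_field, euclidean_space}\<close>. Both \<open>real\<close> and
  \<open>complex\<close> have this sort, and up to isomorphism they are the only such fields (a finite-dimensional
  commutative field extension of the reals is the reals or the complex numbers, and an absolute
  value on it extending the usual one on the reals is unique). Hence real and complex Banach
  spaces are treated at once. The type class \<open>banach\<close> only provides multiplication by reals, so the
  multiplication by scalars is an explicit parameter \<open>sc\<close>.
\<close>

locale normed_space_over = vector_space sc
  for sc :: "'k::{real_normed_field,euclidean_space} \<Rightarrow> 'a::real_normed_vector \<Rightarrow> 'a" +
  assumes norm_scale: "norm (sc c x) = norm c * norm x"
    and scale_of_real: "sc (of_real r) x = r *\<^sub>R x"

lemma normed_space_over_scaleR: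
  "normed_space_over (scaleR :: real \<Rightarrow> 'a::real_normed_vector \<Rightarrow> 'a)"
  by unfold_locales (auto simp: algebra_simps)

lemma normed_space_over_complex: "normed_space_over ((*) :: complex \<Rightarrow> complex \<Rightarrow> complex)"
  by unfold_locales (auto simp: algebra_simps norm_mult scaleR_conv_of_real)

definition dual ::
  "('k::{real_normed_field,euclidean_space} \<Rightarrow> 'a::real_normed_vector \<Rightarrow> 'a) \<Rightarrow> ('a \<Rightarrow> 'k) set" where
  "dual sc = {f. bounded_linear f \<and> (\<forall>c x. f (sc c x) = c * f x)}"

text \<open>
  A Banach space \<open>Z\<close> of scalar sequences with its norm \<open>nrm\<close>, whose values outside \<open>Z\<close> are
  irrelevant. Sequences are indexed from 0.
\<close>

locale banach_sequence_space =
  fixes Z :: "(nat \<Rightarrow> 'k::{real_normed_field,euclidean_space}) set"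
    and nrm :: "(nat \<Rightarrow> 'k) \<Rightarrow> real"
  assumes zero_mem: "(\<lambda>i. 0) \<in> Z"
    and add_mem: "\<lbrakk>a \<in> Z; b \<in> Z\<rbrakk> \<Longrightarrow> (\<lambda>i. a i + b i) \<in> Z"
    and scale_mem: "a \<in> Z \<Longrightarrow> (\<lambda>i. c * a i) \<in> Z"
    and nrm_nonneg: "a \<in> Z \<Longrightarrow> 0 \<le> nrm a"
    and nrm_eq_0_iff: "a \<in> Z \<Longrightarrow> nrm a = 0 \<longleftrightarrow> a = (\<lambda>i. 0)"
    and nrm_triangle: "\<lbrakk>a \<in> Z; b \<in> Z\<rbrakk> \<Longrightarrow> nrm (\<lambda>i. a i + b i) \<le> nrm a + nrm b"
    and nrm_scale: "a \<in> Z \<Longrightarrow> nrm (\<lambda>i. c * a i) = norm c * nrm a"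
    and complete:
      "\<lbrakk>\<And>n. s n \<in> Z;
        \<And>e. e > 0 \<Longrightarrow> \<exists>M. \<forall>m\<ge>M. \<forall>n\<ge>M. nrm (\<lambda>i. s m i - s n i) < e\<rbrakk>
       \<Longrightarrow> \<exists>a\<in>Z. (\<lambda>n. nrm (\<lambda>i. s n i - a i)) \<longlonglongrightarrow> 0"
    and continuous_coordinates:
      "\<lbrakk>a \<in> Z; e > 0\<rbrakk> \<Longrightarrow> \<exists>d>0. \<forall>b\<in>Z. nrm (\<lambda>i. b i - a i) < d \<longrightarrow> norm (b j - a j) < e"

definition atomic_decomposition_wrt ::
  "('k::{real_normed_field,euclidean_space} \<Rightarrow> 'a::banach \<Rightarrow> 'a) \<Rightarrow>
    (nat \<Rightarrow> 'k) set \<Rightarrow> ((nat \<Rightarrow> 'k) \<Rightarrow> real) \<Rightarrow> (nat \<Rightarrow> 'a \<Rightarrow> 'k) \<Rightarrow> (nat \<Rightarrow> 'a) \<Rightarrow> bool" where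
  "atomic_decomposition_wrt sc Z nrm x' x \<longleftrightarrow>
    (\<forall>i. x' i \<in> dual sc) \<and>
    (\<exists>A>0. \<exists>B>0. \<forall>v.
      (\<lambda>i. x' i v) \<in> Z \<and>
      A * norm v \<le> nrm (\<lambda>i. x' i v) \<and> nrm (\<lambda>i. x' i v) \<le> B * norm v \<and>
      (\<lambda>i. sc (x' i v) (x i)) sums v)"

definition atomic_decomposition ::
  "('k::{real_normed_field,euclidean_space} \<Rightarrow> 'a::banach \<Rightarrow> 'a) \<Rightarrow>
    (nat \<Rightarrow> 'a \<Rightarrow> 'k) \<Rightarrow> (nat \<Rightarrow> 'a) \<Rightarrow> bool" where
  "atomic_decomposition sc x' x \<longleftrightarrow>
    (\<exists>Z nrm. banach_sequence_space Z nrm \<and> atomic_decomposition_wrt sc Z nrm x' x)"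

definition unconditionally_convergent :: "(nat \<Rightarrow> 'a::real_normed_vector) \<Rightarrow> bool" where
  "unconditionally_convergent f \<longleftrightarrow> (\<forall>\<pi>::nat \<Rightarrow> nat. bij \<pi> \<longrightarrow> summable (\<lambda>i. f (\<pi> i)))"

definition unconditional_atomic_decomposition ::
  "('k::{real_normed_field,euclidean_space} \<Rightarrow> 'a::banach \<Rightarrow> 'a) \<Rightarrow>
    (nat \<Rightarrow> 'a \<Rightarrow> 'k) \<Rightarrow> (nat \<Rightarrow> 'a) \<Rightarrow> bool" where
  "unconditional_atomic_decomposition sc x' x \<longleftrightarrow>
    atomic_decomposition sc x' x \<and>
    (\<forall>v. unconditionally_convergent (\<lambda>i. sc (x' i v) (x i)))"

definition tail_operator ::
  "('k::{real_normed_field,euclidean_space} \<Rightarrow> 'a::banach \<Rightarrow> 'a) \<Rightarrow>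
    (nat \<Rightarrow> 'a \<Rightarrow> 'k) \<Rightarrow> (nat \<Rightarrow> 'a) \<Rightarrow> nat \<Rightarrow> 'a \<Rightarrow> 'a" where
  "tail_operator sc x' x N v = (\<Sum>i. sc (x' (i + N) v) (x (i + N)))"

definition shrinking ::
  "('k::{real_normed_field,euclidean_space} \<Rightarrow> 'a::banach \<Rightarrow> 'a) \<Rightarrow>
    (nat \<Rightarrow> 'a \<Rightarrow> 'k) \<Rightarrow> (nat \<Rightarrow> 'a) \<Rightarrow> bool" where
  "shrinking sc x' x \<longleftrightarrow>
    (\<forall>f\<in>dual sc. (\<lambda>N. onorm (f \<circ> tail_operator sc x' x N)) \<longlonglongrightarrow> 0)"

definition ell1 :: "(nat \<Rightarrow> 'k::real_normed_vector) set" where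
  "ell1 = {a. summable (\<lambda>i. norm (a i))}"

definition ell1_norm :: "(nat \<Rightarrow> 'k::real_normed_vector) \<Rightarrow> real" where
  "ell1_norm a = (\<Sum>i. norm (a i))"

text \<open>
  An isomorphic copy of \<open>ell1\<close> is the range of a linear map \<open>J\<close> that is bounded and bounded below,
  that is, an isomorphism of \<open>ell1\<close> onto its range. Linearity over the full scalar field is required.
\<close>

definition contains_ell1 ::
  "('k::{real_normed_field,euclidean_space} \<Rightarrow> 'a::real_normed_vector \<Rightarrow> 'a) \<Rightarrow> bool" where
  "contains_ell1 sc \<longleftrightarrow>
    (\<exists>J :: (nat \<Rightarrow> 'k) \<Rightarrow> 'a.
      (\<forall>a\<in>ell1. \<forall>b\<in>ell1. J (\<lambda>i. a i + b i) = J a + J b) \<and>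
      (\<forall>c. \<forall>a\<in>ell1. J (\<lambda>i. c * a i) = sc c (J a)) \<and>
      (\<exists>m>0. \<exists>M>0. \<forall>a\<in>ell1. m * ell1_norm a \<le> norm (J a) \<and> norm (J a) \<le> M * ell1_norm a))"

end

theory Submission
  imports Defs "HOL-Complex_Analysis.Great_Picard"
begin

text \<open>
  For a functional \<open>f\<close> put \<open>c i v = x' i v * f (x i)\<close>. Unconditionality makes \<open>(c i v)\<^sub>i\<close> absolutely
  summable, and by Baire's theorem \<open>v \<mapsto> (c i v)\<^sub>i\<close> is a bounded operator into \<open>\<ell>\<^sub>1\<close>. If \<open>f\<close> violates the
  shrinking condition, the tails of this operator are not uniformly small on the unit ball, so it
  is not compact; a gliding hump then gives a bounded sequence whose image, and hence which itself,
  is equivalent to the unit vector basis of \<open>\<ell>\<^sub>1\<close>.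

  Conversely, let \<open>u n\<close> be the unit vectors of a copy of \<open>\<ell>\<^sub>1\<close>. Along a subsequence \<open>r\<close> all coordinates
  \<open>x' i (u (r n))\<close> converge, and if the decomposition is shrinking this makes \<open>f (u (r n))\<close> Cauchy for
  every \<open>f\<close> in the dual. But by the Hahn--Banach theorem some \<open>f\<close> oscillates along this subsequence.
\<close>

subsection \<open>The Hahn--Banach theorem\<close>

text \<open>Homogeneity is only an inequality for \<open>t > 0\<close>, which is easy to check for
  infima; equality for \<open>t \<ge> 0\<close> follows by scaling back with
  \<open>1/t\<close>.\<close>

definition sublinear :: "('a::real_vector \<Rightarrow> real) \<Rightarrow> bool" where
  "sublinear p \<longleftrightarrow>
    (\<forall>x y. p (x + y) \<le> p x + p y) \<and> (\<forall>t x. t > 0 \<longrightarrow> p (t *\<^sub>R x) \<le> t * p x)"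

lemma sublinear_add: "sublinear p \<Longrightarrow> p (x + y) \<le> p x + p y"
  and sublinear_scaleR_le: "sublinear p \<Longrightarrow> t > 0 \<Longrightarrow> p (t *\<^sub>R x) \<le> t * p x"
  by (auto simp: sublinear_def)

lemma sublinear_zero:
  assumes "sublinear p"
  shows "p 0 = 0"
  using sublinear_scaleR_le[OF assms, of 2 0] sublinear_scaleR_le[OF assms, of "1/2" 0] by simp

lemma sublinear_scaleR:
  assumes "sublinear p" "t \<ge> 0"
  shows "p (t *\<^sub>R x) = t * p x"
proof (cases "t = 0")
  case False
  with assms have "t > 0" by simp
  have "p ((1/t) *\<^sub>R t *\<^sub>R x) \<le> (1/t) * p (t *\<^sub>R x)"
    using assms(1) \<open>t > 0\<close> by (intro sublinear_scaleR_le) auto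
  hence "t * p x \<le> p (t *\<^sub>R x)"
    using \<open>t > 0\<close> by (simp add: field_simps)
  with sublinear_scaleR_le[OF assms(1) \<open>t > 0\<close>, of x] show ?thesis by simp
qed (simp add: sublinear_zero[OF assms(1)])

lemma sublinear_minus_ge:
  assumes "sublinear p"
  shows "- p (- x) \<le> p x"
  using sublinear_add[OF assms, of x "- x"] sublinear_zero[OF assms] by simp

text \<open>For fixed \<open>y\<close>, the function \<open>q\<close> pushes \<open>p\<close> down
  along the direction \<open>y\<close>. It is sublinear and below \<open>p\<close>, so minimality
  forces \<open>q = p\<close>; taking \<open>t = 1\<close> in the infimum then gives
  \<open>p x \<le> p (x + y) - p y\<close>, the reverse of subadditivity.\<close>

lemma linear_if_minimal_sublinear:
  assumes p: "sublinear p"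
    and minimal: "\<And>q. sublinear q \<Longrightarrow> (\<And>x. q x \<le> p x) \<Longrightarrow> q = p"
  shows "linear p"
proof -
  have add: "p (x + y) = p x + p y" for x y
  proof -
    define q where "q x = (INF t\<in>{0..}. p (x + t *\<^sub>R y) - t * p y)" for x
    have "- p (- x) \<le> p (x + t *\<^sub>R y) - t * p y" if "t \<ge> 0" for x t
      using sublinear_add[OF p, of "x + t *\<^sub>R y" "- x"] sublinear_scaleR[OF p that, of y] by simp
    hence bdd: "bdd_below ((\<lambda>t. p (x + t *\<^sub>R y) - t * p y) ` {0..})" for x
      by (intro bdd_belowI2) auto
    have q_le: "q x \<le> p (x + t *\<^sub>R y) - t * p y" if "t \<ge> 0" for x t
      unfolding q_def using bdd that by (intro cINF_lower) auto
    have le_q: "z \<le> q x" if "\<And>t. t \<ge> 0 \<Longrightarrow> z \<le> p (x + t *\<^sub>R y) - t * p y" for x z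
      unfolding q_def using that by (intro cINF_greatest) auto
    have "sublinear q"
      unfolding sublinear_def
    proof (intro conjI allI impI)
      fix x x'
      \<comment> \<open>The parameters \<open>s\<close> and \<open>t\<close> of the two infima
        combine to the parameter \<open>s + t\<close> for \<open>x + x'\<close>.\<close>
      have "q (x + x') - (p (x + s *\<^sub>R y) - s * p y) \<le> p (x' + t *\<^sub>R y) - t * p y"
        if "s \<ge> 0" "t \<ge> 0" for s t
        using q_le[of "s + t" "x + x'"] that
          sublinear_add[OF p, of "x + s *\<^sub>R y" "x' + t *\<^sub>R y"]
        by (simp add: algebra_simps)
      hence "q (x + x') - (p (x + s *\<^sub>R y) - s * p y) \<le> q x'" if "s \<ge> 0" for s
        using that by (intro le_q)
      hence "q (x + x') - q x' \<le> p (x + s *\<^sub>R y) - s * p y" if "s \<ge> 0" for s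
        using that by (smt (verit))
      hence "q (x + x') - q x' \<le> q x"
        by (rule le_q)
      thus "q (x + x') \<le> q x + q x'" by simp
    next
      fix s :: real and x
      assume s: "s > 0"
      have "q (s *\<^sub>R x) / s \<le> q x"
      proof (rule le_q)
        fix t :: real assume "t \<ge> 0"
        have "q (s *\<^sub>R x) \<le> p (s *\<^sub>R (x + t *\<^sub>R y)) - s * t * p y"
          using q_le[of "s * t" "s *\<^sub>R x"] s \<open>t \<ge> 0\<close> by (simp add: algebra_simps)
        also have "\<dots> \<le> s * p (x + t *\<^sub>R y) - s * t * p y"
          using sublinear_scaleR_le[OF p s] by simp
        finally show "q (s *\<^sub>R x) / s \<le> p (x + t *\<^sub>R y) - t * p y"
          using s by (simp add: field_simps)
      qed
      thus "q (s *\<^sub>R x) \<le> s * q x" using s by (simp add: field_simps)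
    qed
    hence "q = p"
      using q_le[of 0] by (intro minimal) auto
    thus ?thesis
      using q_le[of 1 x] sublinear_add[OF p, of x y] by simp
  qed
  have minus: "p (- x) = - p x" for x
    using add[of x "- x"] sublinear_zero[OF p] by simp
  show ?thesis
  proof (rule linearI)
    fix t x
    show "p (t *\<^sub>R x) = t *\<^sub>R p x"
      using sublinear_scaleR[OF p, of t x] sublinear_scaleR[OF p, of "- t" x] minus[of "t *\<^sub>R x"]
      by (cases "t \<ge> 0") auto
  qed (rule add)
qed

text \<open>Zorn's lemma for the reversed pointwise order: the pointwise infimum of a chain is again
  sublinear, and a minimal sublinear functional below \<open>p\<close> is linear.\<close>

theorem exists_linear_le_sublinear:
  assumes p: "sublinear p"
  shows "\<exists>g. linear g \<and> (\<forall>x. g x \<le> p x)"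
proof -
  define A where "A = {q. sublinear q \<and> (\<forall>x. q x \<le> p x)}"
  have "\<exists>m\<in>A. \<forall>q\<in>A. m \<ge> q \<longrightarrow> q = m"
  proof (rule predicate_Zorn)
    show "partial_order_on A (relation_of (\<ge>) A)"
      by (auto simp: partial_order_on_def preorder_on_def relation_of_def refl_on_def
          intro!: transI antisymI)
  next
    fix C assume C: "C \<in> Chains (relation_of (\<ge>) A)"
    hence sub: "q \<in> A" if "q \<in> C" for q
      using that by (auto simp: Chains_def relation_of_def)
    have sub': "sublinear q" and le_p: "q x \<le> p x" if "q \<in> C" for q x
      using sub[OF that] by (auto simp: A_def)
    have chain: "q \<le> q' \<or> q' \<le> q" if "q \<in> C" "q' \<in> C" for q q'
      using C that by (auto simp: Chains_def relation_of_def)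
    show "\<exists>u\<in>A. \<forall>q\<in>C. q \<ge> u"
    proof (cases "C = {}")
      case True
      thus ?thesis using p by (auto simp: A_def)
    next
      case False
      define u where "u x = (INF q\<in>C. q x)" for x
      have "- p (- x) \<le> q x" if "q \<in> C" for q x
        using sublinear_minus_ge[OF sub'[OF that], of x] le_p[OF that, of "- x"] by linarith
      hence bdd: "bdd_below ((\<lambda>q. q x) ` C)" for x
        by (intro bdd_belowI2) auto
      have u_le: "u x \<le> q x" if "q \<in> C" for q x
        unfolding u_def using bdd that by (intro cINF_lower) auto
      have le_u: "z \<le> u x" if "\<And>q. q \<in> C \<Longrightarrow> z \<le> q x" for x z
        unfolding u_def using that False by (intro cINF_greatest) auto
      have "sublinear u"
        unfolding sublinear_def
      proof (intro conjI allI impI)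
        fix x y
        \<comment> \<open>Subadditivity of the infimum rests on comparability: two members of the
          chain are both replaced by the smaller one.\<close>
        have *: "u (x + y) - q' y \<le> q x" if "q \<in> C" "q' \<in> C" for q q'
        proof -
          obtain q'' where q'': "q'' \<in> C" "q'' \<le> q" "q'' \<le> q'"
            using chain[OF \<open>q \<in> C\<close> \<open>q' \<in> C\<close>] \<open>q \<in> C\<close> \<open>q' \<in> C\<close> by auto
          have "u (x + y) \<le> q'' x + q'' y"
            using u_le[OF q''(1)] sublinear_add[OF sub'[OF q''(1)]] by (rule order_trans)
          also have "\<dots> \<le> q x + q' y"
            using q''(2,3) by (auto intro: add_mono simp: le_fun_def)
          finally show ?thesis by simp
        qed
        have "u (x + y) - u x \<le> q' y" if "q' \<in> C" for q'
          using le_u[of "u (x + y) - q' y" x] *[OF _ that] by (smt (verit))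
        hence "u (x + y) - u x \<le> u y" by (rule le_u)
        thus "u (x + y) \<le> u x + u y" by simp
      next
        fix t :: real and x
        assume t: "t > 0"
        have "u (t *\<^sub>R x) / t \<le> u x"
        proof (rule le_u)
          fix q assume q: "q \<in> C"
          have "u (t *\<^sub>R x) \<le> t * q x"
            using u_le[OF q] sublinear_scaleR_le[OF sub'[OF q] t] by (rule order_trans)
          thus "u (t *\<^sub>R x) / t \<le> q x" using t by (simp add: field_simps)
        qed
        thus "u (t *\<^sub>R x) \<le> t * u x" using t by (simp add: field_simps)
      qed
      moreover have "u x \<le> p x" for x
        using False u_le le_p by (meson ex_in_conv order_trans)
      ultimately have "u \<in> A" by (simp add: A_def)
      thus ?thesis using u_le by (auto simp: le_fun_def)
    qed
  qed
  then obtain m where m: "m \<in> A" "\<And>q. q \<in> A \<Longrightarrow> q \<le> m \<Longrightarrow> q = m" by blast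
  have "linear m"
  proof (rule linear_if_minimal_sublinear)
    fix q assume q: "sublinear q" "\<And>x. q x \<le> m x"
    moreover have "m x \<le> p x" for x using m(1) by (simp add: A_def)
    ultimately have "q \<in> A" unfolding A_def using order_trans by blast
    with q m(2) show "q = m" by (simp add: le_fun_def)
  qed (use m in \<open>simp add: A_def\<close>)
  with m(1) show ?thesis by (auto simp: A_def)
qed

text \<open>The subspace \<open>R\<close> is the graph of the functional to be extended; single-valuedness of \<open>R\<close>
  follows from the bound.\<close>

theorem hahn_banach_graph:
  fixes R :: "('a::real_normed_vector \<times> real) set"
  assumes R: "subspace R"
    and bound: "\<And>y s. (y, s) \<in> R \<Longrightarrow> s \<le> K * norm y"
    and K: "K \<ge> 0"
  shows "\<exists>g. bounded_linear g \<and> (\<forall>(y, s)\<in>R. g y = s)"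
proof -
  \<comment> \<open>The element \<open>0\<close> of \<open>R\<close> gives
    \<open>p x \<le> K * norm x\<close>, and \<open>(y, s)\<close> gives \<open>p y \<le> s\<close>.
    Hence a linear \<open>g \<le> p\<close> is bounded and at most \<open>s\<close> at
    \<open>y\<close>; passing to \<open>(- y, - s)\<close> gives equality.\<close>
  define p where "p x = (INF z\<in>R. K * norm (x - fst z) + snd z)" for x
  have ne: "R \<noteq> {}" using subspace_0[OF R] by auto
  have lower: "- (K * norm x) \<le> K * norm (x - fst z) + snd z" if "z \<in> R" for x z
  proof -
    have "- z \<in> R" using that R by (rule subspace_neg[rotated])
    hence "- snd z \<le> K * norm (- fst z)" using bound[of "- fst z" "- snd z"]
      by (cases z) simp
    also have "K * norm (- fst z) \<le> K * (norm x + norm (x - fst z))"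
      using norm_triangle_ineq4[of x "x - fst z"] by (intro mult_left_mono K) simp
    finally show ?thesis by (simp add: ring_distribs)
  qed
  have p_le: "p x \<le> K * norm (x - fst z) + snd z" if "z \<in> R" for x z
    unfolding p_def using lower that by (intro cINF_lower bdd_belowI2) auto
  have le_p: "c \<le> p x" if "\<And>z. z \<in> R \<Longrightarrow> c \<le> K * norm (x - fst z) + snd z" for x c
    unfolding p_def using that ne by (intro cINF_greatest) auto
  have "sublinear p"
    unfolding sublinear_def
  proof (intro conjI allI impI)
    fix x y
    have *: "p (x + y) - (K * norm (y - fst w) + snd w) \<le> K * norm (x - fst z) + snd z"
      if "z \<in> R" "w \<in> R" for z w
    proof -
      have "p (x + y) \<le> K * norm (x + y - (fst z + fst w)) + (snd z + snd w)"
        using p_le[OF subspace_add[OF R that]] by simp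
      also have "K * norm (x + y - (fst z + fst w)) \<le> K * (norm (x - fst z) + norm (y - fst w))"
        using norm_triangle_ineq[of "x - fst z" "y - fst w"]
        by (intro mult_left_mono K) (simp add: algebra_simps)
      finally show ?thesis by (simp add: ring_distribs)
    qed
    have "p (x + y) - p x \<le> K * norm (y - fst w) + snd w" if "w \<in> R" for w
      using le_p[OF *[OF _ that]] by simp
    hence "p (x + y) - p x \<le> p y" by (rule le_p)
    thus "p (x + y) \<le> p x + p y" by simp
  next
    fix t :: real and x
    assume t: "t > 0"
    have "p (t *\<^sub>R x) / t \<le> p x"
    proof (rule le_p)
      fix z assume "z \<in> R"
      hence "p (t *\<^sub>R x) \<le> K * norm (t *\<^sub>R x - t *\<^sub>R fst z) + t * snd z"
        using p_le[OF subspace_scale[OF R, of z t]] by simp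
      also have "norm (t *\<^sub>R x - t *\<^sub>R fst z) = t * norm (x - fst z)"
        using t by (simp flip: scaleR_diff_right)
      finally show "p (t *\<^sub>R x) / t \<le> K * norm (x - fst z) + snd z"
        using t by (simp add: field_simps)
    qed
    thus "p (t *\<^sub>R x) \<le> t * p x" using t by (simp add: field_simps)
  qed
  then obtain g where g: "linear g" and g_le: "\<And>x. g x \<le> p x"
    using exists_linear_le_sublinear by blast
  have g_norm: "g x \<le> K * norm x" for x
    using g_le[of x] p_le[OF subspace_0[OF R], of x] by simp
  have "\<bar>g x\<bar> \<le> norm x * K" for x
    using g_norm[of x] g_norm[of "- x"] linear_neg[OF g, of x] by (simp add: mult.commute)
  hence "bounded_linear g"
    using g by (auto simp: bounded_linear_def bounded_linear_axioms_def)
  moreover have "g y = s" if "(y, s) \<in> R" for y s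
  proof -
    have "g y \<le> s" if "(y, s) \<in> R" for y s
      using g_le[of y] p_le[OF that, of y] by simp
    from this[OF that] this[of "- y" "- s"] subspace_neg[OF R that] linear_neg[OF g, of y]
    show ?thesis by simp
  qed
  ultimately show ?thesis by blast
qed

section \<open>From real functionals to functionals over the scalar field\<close>

lemma (in normed_space_over) bounded_linear_sc: "bounded_linear (sc c)"
proof (rule bounded_linear_intro[where K = "norm c"])
  fix r v
  have "sc c (r *\<^sub>R v) = sc (c * of_real r) v"
    by (simp add: scale_of_real[symmetric])
  also have "\<dots> = r *\<^sub>R sc c v"
    by (simp add: scale_of_real[symmetric] mult.commute)
  finally show "sc c (r *\<^sub>R v) = r *\<^sub>R sc c v" .
qed (auto simp: scale_right_distrib norm_scale mult.commute)

text \<open>The form \<open>(c, d) \<mapsto> (c * d) \<bullet> 1\<close> on the scalar field is nondegenerate, hence every real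
  functional \<open>c \<mapsto> g (sc c v)\<close> on the field is of the form \<open>c \<mapsto> (c * d) \<bullet> 1\<close> for a unique \<open>d = f v\<close>.\<close>

lemma (in normed_space_over) exists_dual_with_real_part:
  assumes g: "bounded_linear (g :: 'a \<Rightarrow> real)"
  shows "\<exists>f\<in>dual sc. \<forall>v. f v \<bullet> 1 = g v"
proof -
  \<comment> \<open>\<open>L d\<close> represents the real functional
    \<open>c \<mapsto> (c * d) \<bullet> 1\<close> through the inner product, so \<open>f v\<close>
    is found by inverting \<open>L\<close>.\<close>
  define L :: "'k \<Rightarrow> 'k" where "L d = (\<Sum>b\<in>Basis. ((b * d) \<bullet> 1) *\<^sub>R b)" for d
  have linL: "linear L"
    unfolding L_def
    by (intro linearI) (simp_all add: ring_distribs inner_add_left scaleR_left_distrib sum.distrib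
        scaleR_sum_right)
  have L: "L d \<bullet> c = (c * d) \<bullet> 1" for c d
  proof -
    have "(c * d) \<bullet> 1 = ((\<Sum>b\<in>Basis. (c \<bullet> b) *\<^sub>R b) * d) \<bullet> 1"
      by (simp add: euclidean_representation)
    also have "\<dots> = (\<Sum>b\<in>Basis. (c \<bullet> b) * ((b * d) \<bullet> 1))"
      by (simp add: sum_distrib_right inner_sum_left)
    also have "\<dots> = L d \<bullet> c"
      by (simp add: L_def inner_sum_left inner_commute[of c] mult.commute)
    finally show ?thesis ..
  qed
  have L_inj: "inj L"
  proof (subst linear_injective_0[OF linL], intro allI impI)
    fix d assume "L d = 0"
    hence "(inverse d * d) \<bullet> 1 = 0" using L[of d "inverse d"] by simp
    thus "d = 0" by (cases "d = 0") auto
  qed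
  then obtain L' where L': "linear L'" "\<And>d. L (L' d) = d"
    using linear_injective_isomorphism[OF linL] by blast
  define f where "f v = L' (\<Sum>b\<in>Basis. g (sc b v) *\<^sub>R b)" for v
  have g_sc: "bounded_linear (\<lambda>v. g (sc c v))" for c
    using bounded_linear_compose[OF g bounded_linear_sc] .
  have f_bl: "bounded_linear f"
    unfolding f_def
    by (rule bounded_linear_compose[OF linear_conv_bounded_linear[THEN iffD1, OF L'(1)]])
      (intro bounded_linear_sum bounded_linear_compose[OF bounded_linear_scaleR_left g_sc])
  interpret g: bounded_linear g by fact
  have sc_sum: "sc (\<Sum>b\<in>Basis. r b *\<^sub>R b) v = (\<Sum>b\<in>Basis. r b *\<^sub>R sc b v)" for r :: "'k \<Rightarrow> real" and v
    by (simp add: scale_sum_left scaleR_conv_of_real scale_of_real scale_scale[symmetric]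
        del: scale_scale)
  have f: "(c * f v) \<bullet> 1 = g (sc c v)" for c v
  proof -
    have "(c * f v) \<bullet> 1 = L (f v) \<bullet> c" by (simp add: L)
    also have "\<dots> = (\<Sum>b\<in>Basis. g (sc b v) * (c \<bullet> b))"
      by (simp add: f_def L' inner_sum_left inner_commute[of c])
    also have "\<dots> = g (\<Sum>b\<in>Basis. (c \<bullet> b) *\<^sub>R sc b v)"
      by (simp add: g.sum g.scaleR mult.commute)
    also have "(\<Sum>b\<in>Basis. (c \<bullet> b) *\<^sub>R sc b v) = sc c v"
      by (simp flip: sc_sum add: euclidean_representation)
    finally show ?thesis .
  qed
  have "f (sc c v) = c * f v" for c v
  proof -
    \<comment> \<open>Both sides equal \<open>g (sc (e * c) v)\<close>.\<close>
    have *: "L (f (sc c v)) \<bullet> e = L (c * f v) \<bullet> e" for e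
      using f[of e "sc c v"] f[of "e * c" v] by (simp add: L mult.assoc)
    have "L (f (sc c v)) = L (c * f v)" by (rule euclidean_eqI) (rule *)
    with L_inj show ?thesis by (simp add: inj_eq)
  qed
  moreover have "f v \<bullet> 1 = g v" for v using f[of 1 v] by simp
  ultimately show ?thesis using f_bl by (auto simp: dual_def)
qed

subsection \<open>Unconditional convergence\<close>

text \<open>A bijection of the initial segment onto \<open>G\<close> is glued to one of the
  remaining indices onto the complement. Used on each interval of a partition of the naturals, it
  builds the rearrangement below.\<close>

lemma exists_bij_atLeastLessThan_initial_segment:
  fixes G :: "nat set"
  assumes G: "G \<subseteq> {a..<b}"
  shows "\<exists>p. bij_betw p {a..<b} {a..<b} \<and> bij_betw p {a..<a + card G} G"
proof -
  have fin: "finite G" using G finite_subset by blast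
  have card: "a + card G \<le> b" if "a \<le> b"
    using card_mono[OF _ G] that by simp
  show ?thesis
  proof (cases "a \<le> b")
    case True
    obtain p where p: "bij_betw p {a..<a + card G} G"
      using finite_same_card_bij[of "{a..<a + card G}" G] fin by auto
    obtain q where q: "bij_betw q {a + card G..<b} ({a..<b} - G)"
      using finite_same_card_bij[of "{a + card G..<b}" "{a..<b} - G"] fin G card[OF True]
      by (auto simp: card_Diff_subset)
    define r where "r i = (if i < a + card G then p i else q i)" for i
    have r: "bij_betw r {a..<a + card G} G"
      using p by (subst bij_betw_cong[of _ r p]) (auto simp: r_def)
    have "bij_betw r {a + card G..<b} ({a..<b} - G)"
      using q by (subst bij_betw_cong[of _ r q]) (auto simp: r_def)
    with r have "bij_betw r ({a..<a + card G} \<union> {a + card G..<b}) (G \<union> ({a..<b} - G))"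
      by (rule bij_betw_combine) auto
    moreover have "{a..<a + card G} \<union> {a + card G..<b} = {a..<b}" "G \<union> ({a..<b} - G) = {a..<b}"
      using card[OF True] G by auto
    ultimately show ?thesis using r by metis
  qed (use G in \<open>auto simp: bij_betw_def\<close>)
qed

text \<open>A rearrangement that moves a given large finite block to the front of each of infinitely many
  consecutive intervals destroys the Cauchy property.\<close>

lemma not_unconditionally_convergentI:
  fixes f :: "nat \<Rightarrow> 'a::banach"
  assumes e: "e > 0"
    and large: "\<And>N. \<exists>G. finite G \<and> G \<subseteq> {N..} \<and> e \<le> norm (sum f G)"
  shows "\<not> unconditionally_convergent f"
proof
  assume unc: "unconditionally_convergent f"
  obtain G where G: "\<And>N. finite (G N)" "\<And>N. G N \<subseteq> {N..}" "\<And>N. e \<le> norm (sum f (G N))"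
    using large by metis
  \<comment> \<open>\<open>u N\<close> lies beyond \<open>N\<close> and all of \<open>G N\<close>.
    Iterating it from 0 gives the endpoints \<open>b k\<close> of consecutive intervals, each
    containing its own block \<open>G (b k)\<close>.\<close>
  define u where "u N = Suc (Max (insert N (G N)))" for N
  have u: "N < u N" "G N \<subseteq> {N..<u N}" for N
  proof -
    have "x \<le> Max (insert N (G N))" if "x \<in> insert N (G N)" for x
      using G(1) that by (intro Max_ge) auto
    thus "N < u N" "G N \<subseteq> {N..<u N}" using G(2)[of N]
      by (auto simp: u_def less_Suc_eq_le)
  qed
  define b where "b k = (u ^^ k) 0" for k
  have b_Suc: "b (Suc k) = u (b k)" for k by (simp add: b_def)
  have mono: "strict_mono b" by (intro strict_monoI_Suc) (simp add: b_Suc u)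
  define I where "I k = {b k..<b (Suc k)}" for k
  have "\<forall>k. \<exists>p. bij_betw p (I k) (I k) \<and> bij_betw p {b k..<b k + card (G (b k))} (G (b k))"
    unfolding I_def using u(2) by (intro allI exists_bij_atLeastLessThan_initial_segment)
      (simp add: b_Suc)
  then obtain p where p: "\<And>k. bij_betw (p k) (I k) (I k)"
      "\<And>k. bij_betw (p k) {b k..<b k + card (G (b k))} (G (b k))"
    by metis
  have disj: "disjoint_family I"
  proof -
    have "I i \<inter> I j = {}" if "i < j" for i j
      using that strict_mono_less_eq[OF mono, of "Suc i" j] by (auto simp: I_def)
    thus ?thesis unfolding disjoint_family_on_def
      by (metis Int_commute nat_neq_iff)
  qed
  have "\<exists>k. i \<in> I k" for i
  proof -
    define k where "k = (LEAST k. i < b (Suc k))"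
    have ex: "i < b (Suc i)" using strict_mono_imp_increasing[OF mono, of "Suc i"] by simp
    hence "i < b (Suc k)" unfolding k_def by (rule LeastI)
    moreover have "b k \<le> i"
    proof (cases k)
      case (Suc m)
      hence "\<not> i < b (Suc m)" using not_less_Least[of m "\<lambda>k. i < b (Suc k)"] by (simp add: k_def)
      thus ?thesis using Suc by simp
    qed (simp add: b_def)
    ultimately show ?thesis by (auto simp: I_def)
  qed
  then obtain K where K: "\<And>i. i \<in> I (K i)" by metis
  have K_eq: "K i = k" if "i \<in> I k" for i k
    using disjoint_family_onD[OF disj, of "K i" k] K[of i] that by auto
  have UN: "(\<Union>k. I k) = UNIV" using K by auto
  define \<pi> where "\<pi> i = p (K i) i" for i
  have \<pi>_eq: "\<pi> i = p k i" if "i \<in> I k" for i k using K_eq[OF that] by (simp add: \<pi>_def)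
  have "bij_betw \<pi> (\<Union>k\<in>UNIV. I k) (\<Union>k\<in>UNIV. I k)"
  proof (rule bij_betw_UNION_disjoint[OF disj])
    fix k show "bij_betw \<pi> (I k) (I k)"
      using p(1)[of k] by (subst bij_betw_cong[of _ \<pi> "p k"]) (auto simp: \<pi>_eq)
  qed
  hence "bij \<pi>" by (simp add: UN)
  with unc have "summable (\<lambda>i. f (\<pi> i))" by (simp add: unconditionally_convergent_def)
  then obtain M where "\<forall>m\<ge>M. \<forall>n. norm (\<Sum>i=m..<n. f (\<pi> i)) < e"
    using e unfolding summable_Cauchy by auto
  hence M: "norm (\<Sum>i=m..<n. f (\<pi> i)) < e" if "m \<ge> M" for m n
    using that by simp
  \<comment> \<open>The first \<open>c\<close> indices of \<open>I M\<close> are sent onto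
    \<open>G (b M)\<close>. They start at \<open>b M \<ge> M\<close>, so a sum of norm at least
    \<open>e\<close> over them contradicts the choice of \<open>M\<close>.\<close>
  define c where "c = card (G (b M))"
  have "c \<le> b (Suc M) - b M"
    using card_mono[OF _ u(2)[of "b M"]] by (simp add: c_def b_Suc)
  hence "{b M..<b M + c} \<subseteq> I M"
    using strict_mono_less[OF mono, of M "Suc M"] by (auto simp: I_def)
  hence "\<pi> i = p M i" if "i \<in> {b M..<b M + c}" for i
    using that by (blast intro: \<pi>_eq)
  hence "(\<Sum>i=b M..<b M + c. f (\<pi> i)) = (\<Sum>i=b M..<b M + c. f (p M i))"
    by (intro sum.cong) simp_all
  also have "\<dots> = sum f (G (b M))"
    using p(2)[of M] unfolding c_def by (rule sum.reindex_bij_betw)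
  finally show False
    using G(3)[of "b M"] M[of "b M" "b M + c"] strict_mono_imp_increasing[OF mono, of M]
    by simp
qed

text \<open>If the sums of absolute values were unbounded, then beyond every \<open>N\<close> some
  finite stretch would have absolute sum above 2, and either its nonnegative or its negative terms
  alone would sum to at least 1 in absolute value.\<close>

lemma unconditionally_convergent_imp_summable_abs:
  fixes a :: "nat \<Rightarrow> real"
  assumes "unconditionally_convergent a"
  shows "summable (\<lambda>i. \<bar>a i\<bar>)"
proof (rule ccontr)
  assume ns: "\<not> summable (\<lambda>i. \<bar>a i\<bar>)"
  have "\<exists>G. finite G \<and> G \<subseteq> {N..} \<and> 1 \<le> norm (sum a G)" for N
  proof -
    have "\<not> summable (\<lambda>i. \<bar>a (i + N)\<bar>)" using ns summable_iff_shift[of "\<lambda>i. \<bar>a i\<bar>" N] by simp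
    then obtain n where n: "(\<Sum>i<n. \<bar>a (i + N)\<bar>) > 2"
      using summableI_nonneg_bounded[of "\<lambda>i. \<bar>a (i + N)\<bar>" 2] by (meson abs_ge_zero not_le)
    define P where "P = {i\<in>{N..<N + n}. a i \<ge> 0}"
    define Q where "Q = {i\<in>{N..<N + n}. a i < 0}"
    have "(\<Sum>i<n. \<bar>a (i + N)\<bar>) = (\<Sum>i\<in>{N..<N + n}. \<bar>a i\<bar>)"
      by (rule sum.reindex_bij_witness[of _ "\<lambda>i. i - N" "\<lambda>i. i + N"]) auto
    also have "{N..<N + n} = P \<union> Q" by (auto simp: P_def Q_def)
    also have "(\<Sum>i\<in>P \<union> Q. \<bar>a i\<bar>) = (\<Sum>i\<in>P. \<bar>a i\<bar>) + (\<Sum>i\<in>Q. \<bar>a i\<bar>)"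
      by (intro sum.union_disjoint) (auto simp: P_def Q_def)
    also have "(\<Sum>i\<in>P. \<bar>a i\<bar>) = sum a P"
      by (intro sum.cong) (auto simp: P_def)
    also have "(\<Sum>i\<in>Q. \<bar>a i\<bar>) = - sum a Q"
      unfolding sum_negf[symmetric] by (intro sum.cong) (auto simp: Q_def)
    finally have "1 \<le> norm (sum a P) \<or> 1 \<le> norm (sum a Q)" using n by auto
    moreover have "finite P" "finite Q" "P \<subseteq> {N..}" "Q \<subseteq> {N..}" by (auto simp: P_def Q_def)
    ultimately show ?thesis by blast
  qed
  with not_unconditionally_convergentI[of 1 a] assms show False by simp
qed

lemma unconditionally_convergent_bounded_linear:
  assumes "bounded_linear h" "unconditionally_convergent f"
  shows "unconditionally_convergent (\<lambda>i. h (f i))"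
  using assms bounded_linear.summable[OF assms(1)] by (auto simp: unconditionally_convergent_def)

text \<open>The real case applies to each of the finitely many coordinates, whose absolute values
  together dominate the norm.\<close>

lemma unconditionally_convergent_imp_summable_norm:
  fixes y :: "nat \<Rightarrow> 'k::euclidean_space"
  assumes "unconditionally_convergent y"
  shows "summable (\<lambda>i. norm (y i))"
proof (rule summable_comparison_test'[of _ 0])
  show "summable (\<lambda>i. \<Sum>b\<in>Basis. \<bar>y i \<bullet> b\<bar>)"
    using assms
    by (intro summable_sum unconditionally_convergent_imp_summable_abs
        unconditionally_convergent_bounded_linear[OF bounded_linear_inner_left])
  show "norm (norm (y i)) \<le> (\<Sum>b\<in>Basis. \<bar>y i \<bullet> b\<bar>)" for i
    using norm_le_l1[of "y i"] by simp
qed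

text \<open>The sets \<open>A m\<close> are closed and cover the Banach space, so by Baire's theorem
  one of them contains a ball; translating and rescaling that ball gives the constant.\<close>

lemma uniform_bound_suminf_norm:
  fixes c :: "nat \<Rightarrow> 'a::banach \<Rightarrow> 'k::real_normed_vector"
  assumes c: "\<And>i. bounded_linear (c i)"
    and sm: "\<And>v. summable (\<lambda>i. norm (c i v))"
  shows "\<exists>C\<ge>0. \<forall>v. (\<Sum>i. norm (c i v)) \<le> C * norm v"
proof -
  define A where "A m = {v. \<forall>n. (\<Sum>i<n. norm (c i v)) \<le> real m}" for m
  have closed: "closed (A m)" for m
  proof -
    have "closed {v. (\<Sum>i<n. norm (c i v)) \<le> real m}" for n
      by (intro closed_Collect_le continuous_on_sum continuous_on_norm continuous_on_const
          linear_continuous_on[OF c])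
    moreover have "A m = (\<Inter>n. {v. (\<Sum>i<n. norm (c i v)) \<le> real m})" by (auto simp: A_def)
    ultimately show ?thesis by (simp add: closed_INT)
  qed
  have "v \<in> (\<Union>m. A m)" for v
  proof -
    obtain m :: nat where "(\<Sum>i. norm (c i v)) \<le> real m" using real_arch_simple by blast
    hence "v \<in> A m"
      unfolding A_def using sum_le_suminf[OF sm] by (auto intro: order_trans)
    thus ?thesis by blast
  qed
  hence UN: "\<Union>(range A) = UNIV" by auto
  have "\<exists>m. interior (A m) \<noteq> {}"
  proof (rule ccontr)
    assume "\<not> ?thesis"
    hence "Met_TC.mtopology interior_of \<Union>(range A) = {}"
      using closed complete_UNIV
      by (intro Met_TC.metric_Baire_category_alt) (auto simp: interior_of_def interior_def)
    thus False by (simp add: UN)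
  qed
  then obtain m v0 where "v0 \<in> interior (A m)" by auto
  then obtain e where e: "e > 0" and ball: "cball v0 e \<subseteq> A m"
    by (auto simp: mem_interior_cball)
  show ?thesis
  proof (intro exI[of _ "2 * m / e"] conjI allI)
    show "0 \<le> 2 * m / e" using e by simp
    fix v
    show "(\<Sum>i. norm (c i v)) \<le> 2 * m / e * norm v"
    proof (cases "v = 0")
      case True
      thus ?thesis using linear_0[OF bounded_linear.linear[OF c]] by simp
    next
      case False
      \<comment> \<open>\<open>w\<close> is \<open>v\<close> rescaled to the radius of the ball. It
        is the difference of the points \<open>v0 + w\<close> and \<open>v0\<close> of
        \<open>A m\<close>, whence the bound \<open>2 * m\<close>.\<close>
      define w where "w = (e / norm v) *\<^sub>R v"
      have nw: "norm w = e" using False e by (simp add: w_def)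
      have "v0 + w \<in> A m" "v0 \<in> A m" using ball nw e by (auto simp: subset_iff dist_norm)
      hence b: "(\<Sum>i<n. norm (c i (v0 + w))) \<le> m" "(\<Sum>i<n. norm (c i v0)) \<le> m" for n
        by (auto simp: A_def)
      have "(\<Sum>i. norm (c i w)) \<le> 2 * m"
      proof (rule suminf_le_const[OF sm])
        fix n
        have "norm (c i w) \<le> norm (c i (v0 + w)) + norm (c i v0)" for i
          using norm_triangle_ineq4[of "c i (v0 + w)" "c i v0"]
          by (simp add: linear_add[OF bounded_linear.linear[OF c]])
        hence "(\<Sum>i<n. norm (c i w)) \<le> (\<Sum>i<n. norm (c i (v0 + w)) + norm (c i v0))"
          by (intro sum_mono)
        thus "(\<Sum>i<n. norm (c i w)) \<le> 2 * m" using b[of n] by (simp add: sum.distrib)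
      qed
      moreover have "norm (c i w) = e / norm v * norm (c i v)" for i
        using e by (simp add: w_def linear_scale[OF bounded_linear.linear[OF c]])
      ultimately have "e / norm v * (\<Sum>i. norm (c i v)) \<le> 2 * m"
        by (simp only: suminf_mult[OF sm])
      thus ?thesis using e False by (simp add: field_simps)
    qed
  qed
qed

subsection \<open>Copies of \<open>\<ell>\<^sub>1\<close>\<close>

lemma dual_bounded_linear: "f \<in> dual sc \<Longrightarrow> bounded_linear f"
  and dual_sc: "f \<in> dual sc \<Longrightarrow> f (sc c v) = c * f v"
  by (auto simp: dual_def)

lemma dual_linear: "f \<in> dual sc \<Longrightarrow> linear f"
  by (rule bounded_linear.linear[OF dual_bounded_linear])

lemmas dual_diff = linear_diff[OF dual_linear]
  and dual_sum = linear_sum[OF dual_linear]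

lemma linear_unit_bound:
  fixes h :: "'b::real_normed_vector \<Rightarrow> 'c::real_normed_vector"
  assumes "linear h" "\<And>u. norm u = 1 \<Longrightarrow> norm (h u) \<le> b"
  shows "norm (h v) \<le> b * norm v"
proof (cases "v = 0")
  case False
  have "norm (h ((1 / norm v) *\<^sub>R v)) \<le> b"
    using False by (intro assms(2)) simp
  thus ?thesis using False by (simp add: linear_scale[OF assms(1)] field_simps)
qed (simp add: linear_0[OF assms(1)])

text \<open>Boundedness of \<open>d\<close> makes the series \<open>J a\<close> absolutely
  convergent for every \<open>a\<close> in \<open>ell1\<close>, and the lower estimate for finite
  sums passes to the limit.\<close>

lemma contains_ell1I:
  fixes sc :: "'k::{real_normed_field,euclidean_space} \<Rightarrow> 'a::banach \<Rightarrow> 'a"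
    and d :: "nat \<Rightarrow> 'a"
  assumes sc: "normed_space_over sc"
    and upper: "\<And>k. norm (d k) \<le> M"
    and m: "m > 0"
    and lower: "\<And>a n. m * (\<Sum>k<n. norm (a k)) \<le> norm (\<Sum>k<n. sc (a k) (d k))"
  shows "contains_ell1 sc"
proof -
  interpret normed_space_over sc by fact
  define J where "J a = (\<Sum>k. sc (a k) (d k))" for a
  have M: "M \<ge> 0" using upper[of 0] norm_ge_zero order_trans by blast
  have le: "norm (sc (a k) (d k)) \<le> M * norm (a k)" for a :: "nat \<Rightarrow> 'k" and k
    using upper[of k] by (simp add: norm_scale mult.commute[of "norm (a k)"] mult_right_mono)
  have sumn: "summable (\<lambda>k. norm (sc (a k) (d k)))" if "a \<in> ell1" for a
    by (rule summable_comparison_test'[of "\<lambda>k. M * norm (a k)" 0, OF summable_mult])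
      (use that le in \<open>auto simp: ell1_def\<close>)
  have sm: "summable (\<lambda>k. sc (a k) (d k))" if "a \<in> ell1" for a
    using summable_norm_cancel[OF sumn[OF that]] .
  have J_add: "J (\<lambda>i. a i + b i) = J a + J b" if "a \<in> ell1" "b \<in> ell1" for a b
    using suminf_add[OF sm[OF that(1)] sm[OF that(2)]] by (simp add: J_def scale_left_distrib)
  have J_scale: "J (\<lambda>i. c * a i) = sc c (J a)" if "a \<in> ell1" for a c
  proof -
    have "J (\<lambda>i. c * a i) = (\<Sum>k. sc c (sc (a k) (d k)))" by (simp add: J_def)
    also have "\<dots> = sc c (J a)"
      unfolding J_def by (rule bounded_linear.suminf[OF bounded_linear_sc sm[OF that], symmetric])
    finally show ?thesis .
  qed
  have J_lower: "m * ell1_norm a \<le> norm (J a)" if a: "a \<in> ell1" for a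
    unfolding J_def ell1_norm_def
  proof (rule LIMSEQ_le)
    show "(\<lambda>n. m * (\<Sum>k<n. norm (a k))) \<longlonglongrightarrow> m * (\<Sum>k. norm (a k))"
      using a by (intro tendsto_intros summable_LIMSEQ) (simp add: ell1_def)
    show "(\<lambda>n. norm (\<Sum>k<n. sc (a k) (d k))) \<longlonglongrightarrow> norm (\<Sum>k. sc (a k) (d k))"
      by (intro tendsto_intros summable_LIMSEQ sm a)
  qed (use lower in auto)
  \<comment> \<open>Only \<open>M \<ge> 0\<close> has been derived, whereas
    \<open>contains_ell1\<close> asks for a positive upper constant; hence
    \<open>M + 1\<close>.\<close>
  have J_upper: "norm (J a) \<le> (M + 1) * ell1_norm a" if a: "a \<in> ell1" for a
  proof -
    have sma: "summable (\<lambda>k. norm (a k))" using a by (simp add: ell1_def)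
    have "norm (J a) \<le> (\<Sum>k. norm (sc (a k) (d k)))"
      unfolding J_def by (rule summable_norm[OF sumn[OF a]])
    also have "\<dots> \<le> (\<Sum>k. M * norm (a k))"
      using sma by (intro suminf_le le sumn a summable_mult)
    also have "\<dots> = M * ell1_norm a"
      by (simp add: ell1_norm_def suminf_mult[OF sma])
    also have "\<dots> \<le> (M + 1) * ell1_norm a"
      using suminf_nonneg[OF sma] by (simp add: ell1_norm_def ring_distribs)
    finally show ?thesis .
  qed
  have "M + 1 > 0" using M by simp
  with m J_add J_scale J_lower J_upper show ?thesis
    unfolding contains_ell1_def by blast
qed

text \<open>Gliding hump for the operator \<open>v \<mapsto> (c i v)\<^sub>i\<close> into the absolutely summable sequences: the
  images of suitably chosen terms of \<open>d\<close> are almost disjoint blocks, so they, and hence the terms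
  themselves, are equivalent to the unit vector basis.\<close>

lemma contains_ell1_gliding_hump:
  fixes sc :: "'k::{real_normed_field,euclidean_space} \<Rightarrow> 'a::banach \<Rightarrow> 'a"
    and c :: "nat \<Rightarrow> 'a \<Rightarrow> 'k"
  assumes sc: "normed_space_over sc"
    and c: "\<And>i. c i \<in> dual sc"
    and sm: "\<And>v. summable (\<lambda>i. norm (c i v))"
    and C: "\<And>v. (\<Sum>i. norm (c i v)) \<le> C * norm v"
    and d: "\<And>k. norm (d k) \<le> M"
    and lim: "\<And>i. (\<lambda>k. c i (d k)) \<longlonglongrightarrow> 0"
    and \<delta>: "\<delta> > 0" "\<And>k. \<delta> \<le> (\<Sum>i. norm (c i (d k)))"
  shows "contains_ell1 sc"
proof -
  \<comment> \<open>Outside the block from \<open>N\<close> to \<open>N'\<close>, the coefficients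
    of \<open>d k\<close> have mass below \<open>\<delta> / 4\<close>. Given \<open>N\<close>, first
    \<open>k\<close> is chosen, since the first \<open>N\<close> coordinates tend to 0, and then
    \<open>N'\<close> cuts off the tail of that one term.\<close>
  define Q where "Q = (\<lambda>N k N'. N \<le> N' \<and> (\<Sum>i<N. norm (c i (d k))) < \<delta> / 8 \<and>
    (\<Sum>i. norm (c (i + N') (d k))) < \<delta> / 8)"
  have step: "\<exists>k N'. Q N k N'" for N
  proof -
    have "(\<lambda>k. \<Sum>i<N. norm (c i (d k))) \<longlonglongrightarrow> (\<Sum>i<N. norm (0::'k))"
      by (intro tendsto_intros lim)
    hence "\<forall>\<^sub>F k in sequentially. (\<Sum>i<N. norm (c i (d k))) < \<delta> / 8"
      using \<delta> by (intro order_tendstoD(2)) auto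
    from eventually_happens'[OF sequentially_bot this] obtain k where k: "(\<Sum>i<N. norm (c i (d k))) < \<delta> / 8"
      by blast
    have "(\<lambda>N'. \<Sum>i. norm (c (i + N') (d k))) \<longlonglongrightarrow> 0"
      using suminf_exist_split2[OF sm] .
    hence "\<forall>\<^sub>F N' in sequentially. N \<le> N' \<and> (\<Sum>i. norm (c (i + N') (d k))) < \<delta> / 8"
      using \<delta> by (intro eventually_conj eventually_ge_at_top order_tendstoD(2)) auto
    from eventually_happens'[OF sequentially_bot this] obtain N' where "N \<le> N' \<and> (\<Sum>i. norm (c (i + N') (d k))) < \<delta> / 8"
      by blast
    with k show ?thesis by (auto simp: Q_def)
  qed
  have "\<exists>F. \<forall>n. True \<and> (case (F n, F (Suc n)) of ((k, N), (k', N')) \<Rightarrow> Q N k' N')"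
    using step by (intro dependent_nat_choice) fastforce+
  then obtain F where F: "\<And>n. Q (snd (F n)) (fst (F (Suc n))) (snd (F (Suc n)))"
    by (auto simp: case_prod_unfold)
  \<comment> \<open>Stage \<open>Suc n\<close> supplies both the term \<open>w n\<close> and the end
    of its block; the block starts where stage \<open>n\<close> ended.\<close>
  define N where "N n = snd (F n)" for n
  define w where "w n = d (fst (F (Suc n)))" for n
  have N: "N n \<le> N (Suc n)"
    and head: "(\<Sum>i<N n. norm (c i (w n))) < \<delta> / 8"
    and tail: "(\<Sum>i. norm (c (i + N (Suc n)) (w n))) < \<delta> / 8" for n
    using F[of n] by (auto simp: Q_def N_def w_def)
  have mono: "mono N" using N by (simp add: mono_iff_le_Suc)
  define s where "s n = (\<Sum>i. norm (c i (w n)))" for n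
  have s: "s n \<ge> \<delta>" for n using \<delta>(2) by (simp add: s_def w_def)
  have hump: "(\<Sum>i=N n..<N (Suc n). norm (c i (w n))) \<ge> s n - \<delta> / 4" for n
  proof -
    have "s n = (\<Sum>i. norm (c (i + N (Suc n)) (w n))) + (\<Sum>i<N (Suc n). norm (c i (w n)))"
      unfolding s_def by (rule suminf_split_initial_segment[OF sm])
    also have "(\<Sum>i<N (Suc n). norm (c i (w n))) =
        (\<Sum>i<N n. norm (c i (w n))) + (\<Sum>i=N n..<N (Suc n). norm (c i (w n)))"
      using sum.atLeastLessThan_concat[of 0 "N n" "N (Suc n)" "\<lambda>i. norm (c i (w n))"] N[of n]
      by (simp add: lessThan_atLeast0)
    finally show ?thesis using head[of n] tail[of n] by linarith
  qed
  \<comment> \<open>The right-hand side is the mass of \<open>w n\<close> inside its block minus the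
    mass outside, which is what survives the triangle inequality in \<open>key\<close>.\<close>
  have hump2: "\<delta> / 2 \<le> 2 * (\<Sum>i=N n..<N (Suc n). norm (c i (w n))) - s n" for n
    using hump[of n] s[of n] by linarith
  have blocks: "(\<Sum>j<n. sum g {N j..<N (Suc j)}) = sum g {N 0..<N n}" for g :: "nat \<Rightarrow> real" and n
  proof (induction n)
    case (Suc n)
    thus ?case using sum.atLeastLessThan_concat[of "N 0" "N n" "N (Suc n)" g] N[of n]
      monoD[OF mono, of 0 n] by simp
  qed simp
  have finite_le: "(\<Sum>i=p..<q. norm (c i v)) \<le> (\<Sum>i. norm (c i v))" for p q v
    by (intro sum_le_suminf sm) auto
  have key: "\<delta> / 2 * (\<Sum>k<n. norm (a k)) \<le> C * norm (\<Sum>k<n. sc (a k) (w k))" for a n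
  proof -
    define X where "X = (\<Sum>k<n. sc (a k) (w k))"
    have cX: "c i X = (\<Sum>k<n. a k * c i (w k))" for i
      by (simp add: X_def dual_sum[OF c] dual_sc[OF c])
    \<comment> \<open>The reverse triangle inequality isolates the \<open>j\<close>-th summand.
      Subtracting the full sum instead of the sum over the other indices produces the factor 2 and a
      term independent of \<open>j\<close>.\<close>
    have pt: "norm (c i X) \<ge> 2 * (norm (a j) * norm (c i (w j))) - (\<Sum>k<n. norm (a k) * norm (c i (w k)))"
      if "j < n" for i j
    proof -
      have "c i X = a j * c i (w j) + (\<Sum>k\<in>{..<n} - {j}. a k * c i (w k))"
        unfolding cX using that by (intro sum.remove) auto
      hence "norm (c i X) \<ge> norm (a j * c i (w j)) - norm (\<Sum>k\<in>{..<n} - {j}. a k * c i (w k))"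
        by (simp add: norm_diff_ineq)
      moreover have "norm (\<Sum>k\<in>{..<n} - {j}. a k * c i (w k)) \<le>
          (\<Sum>k\<in>{..<n} - {j}. norm (a k) * norm (c i (w k)))"
        by (rule sum_norm_le) (simp add: norm_mult)
      moreover have "(\<Sum>k<n. norm (a k) * norm (c i (w k))) = norm (a j) * norm (c i (w j)) +
          (\<Sum>k\<in>{..<n} - {j}. norm (a k) * norm (c i (w k)))"
        using that by (intro sum.remove) auto
      ultimately show ?thesis by (simp add: norm_mult)
    qed
    have "\<delta> / 2 * (\<Sum>k<n. norm (a k)) = (\<Sum>k<n. norm (a k) * (\<delta> / 2))"
      by (simp add: sum_distrib_left mult.commute)
    also have "\<dots> \<le> (\<Sum>k<n. norm (a k) *
        (2 * (\<Sum>i=N k..<N (Suc k). norm (c i (w k))) - s k))"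
      using hump2 by (intro sum_mono mult_left_mono) auto
    also have "\<dots> = (\<Sum>k<n. 2 * norm (a k) * (\<Sum>i=N k..<N (Suc k). norm (c i (w k)))) -
        (\<Sum>k<n. norm (a k) * s k)"
      by (simp add: sum_subtractf right_diff_distrib mult.assoc mult.left_commute)
    \<comment> \<open>Replacing \<open>s k\<close> by its part between \<open>N 0\<close> and
      \<open>N n\<close> leaves finite sums, which can be exchanged and split into blocks.\<close>
    also have "\<dots> \<le> (\<Sum>k<n. 2 * norm (a k) * (\<Sum>i=N k..<N (Suc k). norm (c i (w k)))) -
        (\<Sum>k<n. norm (a k) * (\<Sum>i=N 0..<N n. norm (c i (w k))))"
      using finite_le by (intro diff_left_mono sum_mono mult_left_mono) (auto simp: s_def)
    also have "(\<Sum>k<n. norm (a k) * (\<Sum>i=N 0..<N n. norm (c i (w k)))) =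
        (\<Sum>i=N 0..<N n. \<Sum>k<n. norm (a k) * norm (c i (w k)))"
      unfolding sum_distrib_left by (rule sum.swap)
    also have "\<dots> = (\<Sum>j<n. \<Sum>i=N j..<N (Suc j). \<Sum>k<n. norm (a k) * norm (c i (w k)))"
      by (rule blocks[symmetric])
    also have "(\<Sum>k<n. 2 * norm (a k) * (\<Sum>i=N k..<N (Suc k). norm (c i (w k)))) - \<dots> =
        (\<Sum>j<n. \<Sum>i=N j..<N (Suc j). 2 * (norm (a j) * norm (c i (w j))) -
          (\<Sum>k<n. norm (a k) * norm (c i (w k))))"
      by (simp add: sum_subtractf sum_distrib_left mult.assoc)
    also have "\<dots> \<le> (\<Sum>j<n. \<Sum>i=N j..<N (Suc j). norm (c i X))"
      using pt by (intro sum_mono) auto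
    also have "\<dots> = (\<Sum>i=N 0..<N n. norm (c i X))" by (rule blocks)
    also have "\<dots> \<le> (\<Sum>i. norm (c i X))" by (rule finite_le)
    also have "\<dots> \<le> C * norm X" by (rule C)
    finally show ?thesis by (simp add: X_def)
  qed
  \<comment> \<open>Positivity of \<open>C\<close> is forced by the nonzero image of
    \<open>w 0\<close>.\<close>
  have "\<delta> \<le> C * norm (w 0)" using s[of 0] C[of "w 0"] by (simp add: s_def)
  with \<delta>(1) have "C > 0" using mult_nonpos_nonneg[of C "norm (w 0)"] by fastforce
  show ?thesis
  proof (rule contains_ell1I[OF sc])
    show "norm (w k) \<le> M" for k by (simp add: w_def d)
    show "\<delta> / 2 / C > 0" using \<delta>(1) \<open>C > 0\<close> by simp
    show "\<delta> / 2 / C * (\<Sum>k<n. norm (a k)) \<le> norm (\<Sum>k<n. sc (a k) (w k))" for a n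
      using key[where a = a and n = n] \<open>C > 0\<close> by (simp add: field_simps)
  qed
qed

text \<open>Vectors with large tails have a subsequence along which every coordinate converges.
  Differences of sufficiently distant terms then have coordinates tending to 0 but large coefficient
  sums, as the gliding hump requires.\<close>

lemma contains_ell1_if_tails_not_uniform:
  fixes sc :: "'k::{real_normed_field,euclidean_space} \<Rightarrow> 'a::banach \<Rightarrow> 'a"
    and c :: "nat \<Rightarrow> 'a \<Rightarrow> 'k"
  assumes sc: "normed_space_over sc"
    and c: "\<And>i. c i \<in> dual sc"
    and sm: "\<And>v. summable (\<lambda>i. norm (c i v))"
    and C: "\<And>v. (\<Sum>i. norm (c i v)) \<le> C * norm v" "C \<ge> 0"
    and \<epsilon>: "\<epsilon> > 0"
    and tails: "\<And>N. \<exists>v. norm v \<le> 1 \<and> \<epsilon> < (\<Sum>i. norm (c (i + N) v))"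
  shows "contains_ell1 sc"
proof -
  obtain v where v: "\<And>N. norm (v N) \<le> 1" "\<And>N. \<epsilon> < (\<Sum>i. norm (c (i + N) (v N)))"
    using tails by metis
  have bound: "norm (c i (v n)) \<le> C" for i n
  proof -
    have "norm (c i (v n)) \<le> (\<Sum>i. norm (c i (v n)))"
      using sum_le_suminf[OF sm, of "{i}" "v n"] by simp
    also have "\<dots> \<le> C * 1" using C(1)[of "v n"] mult_left_mono[OF v(1)[of n] C(2)] by simp
    finally show ?thesis by simp
  qed
  obtain r :: "nat \<Rightarrow> nat" where r: "strict_mono r"
    "\<And>i. i \<in> UNIV \<Longrightarrow> \<exists>l. (\<lambda>n. c i (v (r n))) \<longlonglongrightarrow> l"
    by (rule function_convergent_subsequence[of UNIV "\<lambda>n i. c i (v n)" C]) (use bound in auto)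
  \<comment> \<open>Beyond \<open>r (q n)\<close> the tail of \<open>v (r n)\<close> is below
    \<open>\<epsilon> / 2\<close>, while that of \<open>v (r (q n))\<close> exceeds
    \<open>\<epsilon>\<close> by the choice of \<open>v\<close>; so their difference keeps at least
    \<open>\<epsilon> / 2\<close>.\<close>
  have "\<exists>q\<ge>n. (\<Sum>i. norm (c (i + r q) (v (r n)))) < \<epsilon> / 2" for n
  proof -
    have "(\<lambda>N. \<Sum>i. norm (c (i + N) (v (r n)))) \<longlonglongrightarrow> 0"
      using suminf_exist_split2[OF sm] .
    hence "(\<lambda>q. \<Sum>i. norm (c (i + r q) (v (r n)))) \<longlonglongrightarrow> 0"
      using LIMSEQ_subseq_LIMSEQ[OF _ r(1)] by (fastforce simp: o_def)
    hence "\<forall>\<^sub>F q in sequentially. n \<le> q \<and> (\<Sum>i. norm (c (i + r q) (v (r n)))) < \<epsilon> / 2"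
      using \<epsilon> by (intro eventually_conj eventually_ge_at_top order_tendstoD(2)) auto
    then show ?thesis by (auto simp: eventually_sequentially)
  qed
  then obtain q where q: "\<And>n. q n \<ge> n"
    "\<And>n. (\<Sum>i. norm (c (i + r (q n)) (v (r n)))) < \<epsilon> / 2"
    by metis
  define d where "d n = v (r (q n)) - v (r n)" for n
  show ?thesis
  proof (rule contains_ell1_gliding_hump[OF sc c sm C(1)])
    show "norm (d n) \<le> 2" for n
      using norm_triangle_ineq4[of "v (r (q n))" "v (r n)"] v(1)[of "r (q n)"] v(1)[of "r n"]
      by (simp add: d_def)
    show "(\<lambda>n. c i (d n)) \<longlonglongrightarrow> 0" for i
    proof -
      obtain l where l: "(\<lambda>n. c i (v (r n))) \<longlonglongrightarrow> l" using r(2) by auto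
      have "filterlim q at_top sequentially"
        by (rule filterlim_at_top_mono[OF filterlim_ident]) (use q(1) in auto)
      hence "(\<lambda>n. c i (v (r (q n)))) \<longlonglongrightarrow> l" using filterlim_compose[OF l] by blast
      from tendsto_diff[OF this l] show ?thesis by (simp add: d_def dual_diff[OF c])
    qed
    show "\<epsilon> / 2 > 0" using \<epsilon> by simp
    show "\<epsilon> / 2 \<le> (\<Sum>i. norm (c i (d n)))" for n
    proof -
      let ?s = "\<lambda>u i. norm (c (i + r (q n)) u)"
      have sh: "summable (?s u)" for u by (rule summable_ignore_initial_segment[OF sm])
      have "\<epsilon> < suminf (?s (v (r (q n))))" by (rule v(2))
      also have "\<dots> \<le> (\<Sum>i. ?s (d n) i + ?s (v (r n)) i)"
      proof (rule suminf_le[OF _ sh summable_add[OF sh sh]])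
        fix i show "?s (v (r (q n))) i \<le> ?s (d n) i + ?s (v (r n)) i"
          using norm_triangle_ineq[of "c (i + r (q n)) (d n)" "c (i + r (q n)) (v (r n))"]
          by (simp add: d_def dual_diff[OF c])
      qed
      also have "\<dots> = suminf (?s (d n)) + suminf (?s (v (r n)))"
        by (rule suminf_add[OF sh sh, symmetric])
      also have "suminf (?s (d n)) \<le> (\<Sum>i. norm (c i (d n)))"
        using suminf_split_initial_segment[OF sm, of "d n" "r (q n)"]
          sum_nonneg[of "{..<r (q n)}" "\<lambda>i. norm (c i (d n))"] by simp
      finally show ?thesis using q(2)[of n] by simp
    qed
  qed
qed

text \<open>Extending a functional with values \<open>\<plusminus>1\<close>, alternating along \<open>r\<close>, on the unit vectors of a copy
  of \<open>\<ell>\<^sub>1\<close> shows that no subsequence of these vectors is weakly Cauchy.\<close>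

lemma ell1_copy_separating_functional:
  fixes sc :: "'k::{real_normed_field,euclidean_space} \<Rightarrow> 'a::real_normed_vector \<Rightarrow> 'a"
    and J :: "(nat \<Rightarrow> 'k) \<Rightarrow> 'a"
  assumes sc: "normed_space_over sc"
    and add: "\<And>a b. a \<in> ell1 \<Longrightarrow> b \<in> ell1 \<Longrightarrow> J (\<lambda>i. a i + b i) = J a + J b"
    and scale: "\<And>c a. a \<in> ell1 \<Longrightarrow> J (\<lambda>i. c * a i) = sc c (J a)"
    and m: "m > 0" "\<And>a. a \<in> ell1 \<Longrightarrow> m * ell1_norm a \<le> norm (J a)"
    and r: "strict_mono (r :: nat \<Rightarrow> nat)"
  shows "\<exists>f\<in>dual sc. \<forall>n. f (J (\<lambda>i. if i = r n then 1 else 0)) \<bullet> 1 = (-1) ^ n"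
proof -
  interpret N: normed_space_over sc by fact
  \<comment> \<open>Outside the range of \<open>r\<close> the value of \<open>inv r\<close> is
    unspecified, but \<open>\<sigma>\<close> is a sign everywhere, which suffices for the norm bound
    on \<open>\<phi>\<close>.\<close>
  define \<sigma> :: "nat \<Rightarrow> real" where "\<sigma> i = (-1) ^ inv r i" for i
  define \<phi> :: "(nat \<Rightarrow> 'k) \<Rightarrow> real" where "\<phi> a = (\<Sum>i. \<sigma> i * (a i \<bullet> 1))" for a
  have \<sigma>: "\<bar>\<sigma> i\<bar> = 1" for i by (simp add: \<sigma>_def power_abs)
  have le: "\<bar>\<sigma> i * (z \<bullet> 1)\<bar> \<le> norm z" for i and z :: 'k
    using Cauchy_Schwarz_ineq2[of z 1] by (simp add: abs_mult \<sigma>)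
  have sma: "summable (\<lambda>i. \<bar>\<sigma> i * (a i \<bullet> 1)\<bar>)" if "a \<in> ell1" for a :: "nat \<Rightarrow> 'k"
    by (rule summable_comparison_test'[of "\<lambda>i. norm (a i)" 0])
      (use that le in \<open>auto simp: ell1_def\<close>)
  have sm: "summable (\<lambda>i. \<sigma> i * (a i \<bullet> 1))" if "a \<in> ell1" for a :: "nat \<Rightarrow> 'k"
    using sma[OF that] by (rule summable_rabs_cancel)
  have ell1_add: "(\<lambda>i. a i + b i) \<in> ell1" if "a \<in> ell1" "b \<in> ell1" for a b :: "nat \<Rightarrow> 'k"
  proof -
    have "summable (\<lambda>i. norm (a i) + norm (b i))"
      using that by (intro summable_add) (auto simp: ell1_def)
    thus ?thesis unfolding ell1_def mem_Collect_eq
      by (rule summable_comparison_test'[of _ 0]) (auto intro: norm_triangle_ineq)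
  qed
  have ell1_scale: "(\<lambda>i. c * a i) \<in> ell1" if "a \<in> ell1" for c and a :: "nat \<Rightarrow> 'k"
    using that by (auto simp: ell1_def norm_mult intro: summable_mult)
  have zero: "(\<lambda>i. 0 :: 'k) \<in> ell1" by (simp add: ell1_def)
  \<comment> \<open>This is the graph of \<open>\<phi>\<close> transported to the range of
    \<open>J\<close>; the lower bound on \<open>J\<close> yields the domination constant
    \<open>1 / m\<close>.\<close>
  define R where "R = (\<lambda>a. (J a, \<phi> a)) ` ell1"
  have "subspace R"
  proof (rule subspaceI)
    have "J (\<lambda>i. 0) = 0" using scale[OF zero, of 0] by simp
    moreover have "\<phi> (\<lambda>i. 0) = 0" by (simp add: \<phi>_def)
    ultimately show "0 \<in> R" unfolding R_def
      by (intro image_eqI[OF _ zero]) (simp add: zero_prod_def)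
  next
    fix x y assume "x \<in> R" "y \<in> R"
    then obtain a b where ab: "a \<in> ell1" "b \<in> ell1" "x = (J a, \<phi> a)" "y = (J b, \<phi> b)"
      by (auto simp: R_def)
    have "\<phi> (\<lambda>i. a i + b i) = \<phi> a + \<phi> b"
      using suminf_add[OF sm[OF ab(1)] sm[OF ab(2)]]
      by (simp add: \<phi>_def inner_add_left ring_distribs)
    thus "x + y \<in> R" unfolding R_def
      using ab by (intro image_eqI[OF _ ell1_add[OF ab(1,2)]]) (simp add: add)
  next
    fix t :: real and x assume "x \<in> R"
    then obtain a where a: "a \<in> ell1" "x = (J a, \<phi> a)" by (auto simp: R_def)
    have "\<phi> (\<lambda>i. of_real t * a i) = t * \<phi> a"
      using suminf_mult[OF sm[OF a(1)], of t]
      by (simp add: \<phi>_def scaleR_conv_of_real[symmetric] mult.left_commute)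
    thus "t *\<^sub>R x \<in> R" unfolding R_def
      using a by (intro image_eqI[OF _ ell1_scale[OF a(1), of "of_real t"]])
        (simp add: scale N.scale_of_real)
  qed
  moreover have "s \<le> 1 / m * norm y" if ys: "(y, s) \<in> R" for y s
  proof -
    obtain a where a: "a \<in> ell1" "y = J a" "s = \<phi> a" using ys by (auto simp: R_def)
    have "s \<le> ell1_norm a"
      unfolding a(3) \<phi>_def ell1_norm_def using a(1)
      by (intro suminf_le sm) (auto intro: order_trans[OF abs_ge_self le] simp: ell1_def)
    also have "\<dots> \<le> 1 / m * norm y"
      using m(1) m(2)[OF a(1)] by (simp add: a(2) field_simps)
    finally show ?thesis .
  qed
  ultimately obtain g where g: "bounded_linear g" "\<And>y s. (y, s) \<in> R \<Longrightarrow> g y = s"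
    using hahn_banach_graph[of R "1 / m"] m(1) by fastforce
  then obtain f where f: "f \<in> dual sc" "\<And>v. f v \<bullet> 1 = g v"
    using N.exists_dual_with_real_part by blast
  have "f (J (\<lambda>i. if i = r n then 1 else 0)) \<bullet> 1 = (-1) ^ n" for n
  proof -
    let ?e = "\<lambda>i. if i = r n then 1 else 0 :: 'k"
    have "summable (\<lambda>i. norm (?e i))"
      by (rule summable_finite[of "{r n}"]) auto
    hence "(J ?e, \<phi> ?e) \<in> R" by (auto simp: R_def ell1_def)
    hence "f (J ?e) \<bullet> 1 = \<phi> ?e" using f(2) g(2) by simp
    also have "\<phi> ?e = (\<Sum>i\<in>{r n}. \<sigma> i * (?e i \<bullet> 1))"
      unfolding \<phi>_def by (rule suminf_finite) auto
    also have "\<dots> = (-1) ^ n"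
      using strict_mono_imp_inj_on[OF r] by (simp add: \<sigma>_def dot_square_norm)
    finally show ?thesis .
  qed
  with f(1) show ?thesis by blast
qed

subsection \<open>Unconditional atomic decompositions\<close>

context
  fixes sc :: "'k::{real_normed_field,euclidean_space} \<Rightarrow> 'a::banach \<Rightarrow> 'a"
    and x' :: "nat \<Rightarrow> 'a \<Rightarrow> 'k" and x :: "nat \<Rightarrow> 'a"
  assumes sc: "normed_space_over sc"
    and decomp: "unconditional_atomic_decomposition sc x' x"
begin

lemma coordinate_dual: "x' i \<in> dual sc"
  using decomp
  unfolding unconditional_atomic_decomposition_def atomic_decomposition_def
    atomic_decomposition_wrt_def by blast

lemma expansion: "(\<lambda>i. sc (x' i v) (x i)) sums v"
  using decomp
  unfolding unconditional_atomic_decomposition_def atomic_decomposition_def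
    atomic_decomposition_wrt_def by blast

lemma dual_term:
  assumes f: "f \<in> dual sc"
  shows "(\<lambda>v. x' i v * f (x i)) \<in> dual sc"
  using bounded_linear_mult_const[OF dual_bounded_linear[OF coordinate_dual]]
    dual_sc[OF coordinate_dual] by (auto simp: dual_def mult.assoc)

text \<open>Applying \<open>f\<close> to the expansion gives an unconditionally convergent series in
  the finite-dimensional scalar field, and such a series converges absolutely.\<close>

lemma summable_norm_dual_terms:
  assumes f: "f \<in> dual sc"
  shows "summable (\<lambda>i. norm (x' i v * f (x i)))"
proof -
  have "unconditionally_convergent (\<lambda>i. f (sc (x' i v) (x i)))"
    using decomp by (intro unconditionally_convergent_bounded_linear[OF dual_bounded_linear[OF f]])
      (simp add: unconditional_atomic_decomposition_def)
  thus ?thesis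
    using unconditionally_convergent_imp_summable_norm by (simp add: dual_sc[OF f])
qed

lemma dual_tail_operator:
  assumes f: "f \<in> dual sc"
  shows "f (tail_operator sc x' x N v) = (\<Sum>i. x' (i + N) v * f (x (i + N)))"
    and "f v = (\<Sum>i<N. x' i v * f (x i)) + f (tail_operator sc x' x N v)"
    and "norm (f (tail_operator sc x' x N v)) \<le> (\<Sum>i. norm (x' (i + N) v * f (x (i + N))))"
proof -
  have sm: "summable (\<lambda>i. sc (x' i v) (x i))" using expansion by (rule sums_summable)
  show *: "f (tail_operator sc x' x N v) = (\<Sum>i. x' (i + N) v * f (x (i + N)))"
    unfolding tail_operator_def
    using bounded_linear.suminf[OF dual_bounded_linear[OF f] summable_ignore_initial_segment[OF sm]]
    by (simp add: dual_sc[OF f])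
  have "f v = (\<Sum>i. x' i v * f (x i))"
    using bounded_linear.sums[OF dual_bounded_linear[OF f] expansion[of v]]
    by (simp add: dual_sc[OF f] sums_iff)
  also have "\<dots> = (\<Sum>i. x' (i + N) v * f (x (i + N))) + (\<Sum>i<N. x' i v * f (x i))"
    by (rule suminf_split_initial_segment[OF summable_norm_cancel[OF summable_norm_dual_terms[OF f]]])
  finally show "f v = (\<Sum>i<N. x' i v * f (x i)) + f (tail_operator sc x' x N v)"
    by (simp add: *)
  show "norm (f (tail_operator sc x' x N v)) \<le> (\<Sum>i. norm (x' (i + N) v * f (x (i + N))))"
    unfolding *
    by (rule summable_norm[OF summable_ignore_initial_segment[OF summable_norm_dual_terms[OF f]]])
qed

text \<open>The composition is \<open>f\<close> minus its first \<open>N\<close> terms, a finite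
  combination of bounded functionals.\<close>

lemma bounded_linear_dual_tail_operator:
  assumes f: "f \<in> dual sc"
  shows "bounded_linear (f \<circ> tail_operator sc x' x N)"
proof -
  have "f \<circ> tail_operator sc x' x N = (\<lambda>v. f v - (\<Sum>i<N. x' i v * f (x i)))"
    using dual_tail_operator(2)[OF f] by (auto simp: fun_eq_iff algebra_simps)
  moreover have "bounded_linear (\<lambda>v. f v - (\<Sum>i<N. x' i v * f (x i)))"
    by (intro bounded_linear_sub bounded_linear_sum dual_bounded_linear[OF f]
        dual_bounded_linear[OF dual_term[OF f]])
  ultimately show ?thesis by simp
qed

lemma contains_ell1_if_not_shrinking:
  assumes "\<not> shrinking sc x' x"
  shows "contains_ell1 sc"
proof -
  obtain f where f: "f \<in> dual sc"
    and "\<not> (\<lambda>N. onorm (f \<circ> tail_operator sc x' x N)) \<longlonglongrightarrow> 0"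
    using assms by (auto simp: shrinking_def)
  then obtain \<epsilon> where \<epsilon>: "\<epsilon> > 0"
    and large: "\<And>M. \<exists>N\<ge>M. \<epsilon> \<le> onorm (f \<circ> tail_operator sc x' x N)"
    using onorm_pos_le[OF bounded_linear_dual_tail_operator[OF f]]
    by (auto simp: LIMSEQ_iff not_less)
  define c where "c i v = x' i v * f (x i)" for i v
  have c: "c i \<in> dual sc" for i using dual_term[OF f] by (simp add: c_def[abs_def])
  have sm: "summable (\<lambda>i. norm (c i v))" for v
    using summable_norm_dual_terms[OF f] by (simp add: c_def)
  obtain C where C: "C \<ge> 0" "\<And>v. (\<Sum>i. norm (c i v)) \<le> C * norm v"
    using uniform_bound_suminf_norm[OF dual_bounded_linear[OF c] sm] by blast
  \<comment> \<open>The operator norm is known to be large only for some \<open>N \<ge> M\<close>,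
    but the coefficient tail from \<open>M\<close> dominates the one from \<open>N\<close>. Halving
    \<open>\<epsilon>\<close> makes the contradiction strict.\<close>
  have "\<exists>v. norm v \<le> 1 \<and> \<epsilon> / 2 < (\<Sum>i. norm (c (i + M) v))" for M
  proof (rule ccontr)
    assume no: "\<nexists>v. norm v \<le> 1 \<and> \<epsilon> / 2 < (\<Sum>i. norm (c (i + M) v))"
    obtain N where N: "N \<ge> M" "\<epsilon> \<le> onorm (f \<circ> tail_operator sc x' x N)" using large by blast
    have unit: "norm ((f \<circ> tail_operator sc x' x N) u) \<le> \<epsilon> / 2" if u: "norm u = 1" for u
    proof -
      have "norm ((f \<circ> tail_operator sc x' x N) u) \<le> (\<Sum>i. norm (c (i + N) u))"
        using dual_tail_operator(3)[OF f] by (simp add: c_def)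
      also have "\<dots> \<le> (\<Sum>i. norm (c (i + M) u))"
        using suminf_split_initial_segment[OF summable_ignore_initial_segment[OF sm[of u], of M], of "N - M"]
          sum_nonneg[of "{..<N - M}" "\<lambda>i. norm (c (i + M) u)"] N(1)
        by (simp add: add.assoc)
      also have "\<dots> \<le> \<epsilon> / 2" using no u by (auto simp: not_less)
      finally show ?thesis .
    qed
    have "onorm (f \<circ> tail_operator sc x' x N) \<le> \<epsilon> / 2"
      using \<epsilon> linear_unit_bound
        [OF bounded_linear.linear[OF bounded_linear_dual_tail_operator[OF f]], OF unit]
      by (intro onorm_bound) auto
    with N(2) \<epsilon> show False by simp
  qed
  thus ?thesis
    using \<epsilon> by (intro contains_ell1_if_tails_not_uniform[OF sc c sm C(2,1), of "\<epsilon> / 2"]) auto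
qed

lemma not_contains_ell1_if_shrinking:
  assumes shr: "shrinking sc x' x"
  shows "\<not> contains_ell1 sc"
proof
  assume "contains_ell1 sc"
  then obtain J :: "(nat \<Rightarrow> 'k) \<Rightarrow> 'a" and m M where J:
    "\<And>a b. a \<in> ell1 \<Longrightarrow> b \<in> ell1 \<Longrightarrow> J (\<lambda>i. a i + b i) = J a + J b"
    "\<And>c a. a \<in> ell1 \<Longrightarrow> J (\<lambda>i. c * a i) = sc c (J a)"
    and m: "m > 0" "\<And>a. a \<in> ell1 \<Longrightarrow> m * ell1_norm a \<le> norm (J a)"
    and M: "M > 0" "\<And>a. a \<in> ell1 \<Longrightarrow> norm (J a) \<le> M * ell1_norm a"
    unfolding contains_ell1_def by blast
  define e :: "nat \<Rightarrow> nat \<Rightarrow> 'k" where "e n = (\<lambda>i. if i = n then 1 else 0)" for n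
  have "(\<lambda>i. norm (e n i)) sums (\<Sum>i\<in>{n}. norm (e n i))" for n
    by (rule sums_finite) (auto simp: e_def)
  hence "e n \<in> ell1" "ell1_norm (e n) = 1" for n
    by (auto simp: ell1_def ell1_norm_def sums_iff e_def)
  hence u: "norm (J (e n)) \<le> M" for n using M(2)[of "e n"] by simp
  obtain K where K: "\<And>i. K i > 0" "\<And>i v. norm (x' i v) \<le> norm v * K i"
    using bounded_linear.pos_bounded[OF dual_bounded_linear[OF coordinate_dual]] by metis
  \<comment> \<open>Dividing by \<open>K i\<close> gives all coordinates the common bound
    \<open>M\<close> needed to extract the subsequence; multiplying by \<open>K i\<close> undoes
    this in \<open>d_lim\<close>.\<close>
  have bound: "norm ((1 / K i) *\<^sub>R x' i (J (e n))) \<le> M" for i n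
  proof -
    have "norm (x' i (J (e n))) \<le> M * K i"
      using K(2)[of i "J (e n)"] mult_right_mono[OF u[of n] less_imp_le[OF K(1)[of i]]]
      by linarith
    thus ?thesis using K(1)[of i] by (simp add: field_simps)
  qed
  obtain r :: "nat \<Rightarrow> nat" where r: "strict_mono r"
    "\<And>i. i \<in> UNIV \<Longrightarrow> \<exists>l. (\<lambda>n. (1 / K i) *\<^sub>R x' i (J (e (r n)))) \<longlonglongrightarrow> l"
    by (rule function_convergent_subsequence[of UNIV "\<lambda>n i. (1 / K i) *\<^sub>R x' i (J (e n))" M])
      (use bound in auto)
  obtain f where f: "f \<in> dual sc" "\<And>n. f (J (e (r n))) \<bullet> 1 = (-1) ^ n"
    using ell1_copy_separating_functional[OF sc J m r(1)] unfolding e_def by blast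
  \<comment> \<open>In these differences the limits of the coordinates cancel, whereas the
    alternating signs add up to \<open>f (d n) \<bullet> 1 = 2\<close>.\<close>
  define d where "d n = J (e (r (2 * n))) - J (e (r (2 * n + 1)))" for n
  have d_norm: "norm (d n) \<le> 2 * M" for n
    using norm_triangle_ineq4[of "J (e (r (2 * n)))" "J (e (r (2 * n + 1)))"]
      u[of "r (2 * n)"] u[of "r (2 * n + 1)"] by (simp add: d_def)
  have d_lim: "(\<lambda>n. x' i (d n)) \<longlonglongrightarrow> 0" for i
  proof -
    obtain l where l: "(\<lambda>n. (1 / K i) *\<^sub>R x' i (J (e (r n)))) \<longlonglongrightarrow> l" using r(2) by auto
    have "(\<lambda>n. K i *\<^sub>R (1 / K i) *\<^sub>R x' i (J (e (r n)))) \<longlonglongrightarrow> K i *\<^sub>R l"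
      by (intro tendsto_intros l)
    hence l': "(\<lambda>n. x' i (J (e (r n)))) \<longlonglongrightarrow> K i *\<^sub>R l" using K(1)[of i] by simp
    have "(\<lambda>n. x' i (J (e (r (2 * n))))) \<longlonglongrightarrow> K i *\<^sub>R l"
      "(\<lambda>n. x' i (J (e (r (2 * n + 1))))) \<longlonglongrightarrow> K i *\<^sub>R l"
      using LIMSEQ_subseq_LIMSEQ[OF l', of "\<lambda>n. 2 * n"]
        LIMSEQ_subseq_LIMSEQ[OF l', of "\<lambda>n. 2 * n + 1"]
      by (auto simp: strict_mono_def o_def)
    from tendsto_diff[OF this] show ?thesis by (simp add: d_def dual_diff[OF coordinate_dual])
  qed
  have "(\<lambda>N. onorm (f \<circ> tail_operator sc x' x N)) \<longlonglongrightarrow> 0"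
    using shr f(1) by (simp add: shrinking_def)
  hence "\<forall>\<^sub>F N in sequentially. onorm (f \<circ> tail_operator sc x' x N) < 1 / (2 * M)"
    using M(1) by (intro order_tendstoD(2)) auto
  from eventually_happens'[OF sequentially_bot this] obtain N where N: "onorm (f \<circ> tail_operator sc x' x N) < 1 / (2 * M)"
      by blast
  \<comment> \<open>Since \<open>norm (d n) \<le> 2 * M\<close>, the threshold
    \<open>1 / (2 * M)\<close> lets the tail contribute at most 1. The first \<open>N\<close> terms
    contribute less than 1 for some \<open>n\<close>, so \<open>norm (f (d n)) < 2\<close>.\<close>
  have tail: "norm (f (tail_operator sc x' x N (d n))) \<le> 1" for n
  proof -
    have "norm (f (tail_operator sc x' x N (d n))) \<le>
        onorm (f \<circ> tail_operator sc x' x N) * norm (d n)"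
      using onorm[OF bounded_linear_dual_tail_operator[OF f(1)], of N "d n"] by simp
    also have "\<dots> \<le> 1 / (2 * M) * (2 * M)"
      using N d_norm[of n] M(1) by (intro mult_mono) auto
    finally show ?thesis using M(1) by simp
  qed
  have "(\<lambda>n. norm (\<Sum>i<N. x' i (d n) * f (x i))) \<longlonglongrightarrow> norm (\<Sum>i<N. 0 * f (x i))"
    by (intro tendsto_intros d_lim)
  hence "\<forall>\<^sub>F n in sequentially. norm (\<Sum>i<N. x' i (d n) * f (x i)) < 1"
    by (intro order_tendstoD(2)) auto
  from eventually_happens'[OF sequentially_bot this] obtain n where n: "norm (\<Sum>i<N. x' i (d n) * f (x i)) < 1"
      by blast
  have "norm (f (d n)) < 2"
    using dual_tail_operator(2)[OF f(1), of "d n" N] tail[of n] n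
      norm_triangle_ineq[of "\<Sum>i<N. x' i (d n) * f (x i)" "f (tail_operator sc x' x N (d n))"]
    by simp
  moreover have "f (d n) \<bullet> 1 = 2"
    using f(2)[of "2 * n"] f(2)[of "2 * n + 1"]
    by (simp add: d_def dual_diff[OF f(1)] inner_diff_left)
  moreover have "\<bar>f (d n) \<bullet> 1\<bar> \<le> norm (f (d n))"
    using Cauchy_Schwarz_ineq2[of "f (d n)" 1] by simp
  ultimately show False by simp
qed

end

theorem theorem3p3:
  fixes sc :: "'k::{real_normed_field,euclidean_space} \<Rightarrow> 'a::banach \<Rightarrow> 'a"
    and x' :: "nat \<Rightarrow> 'a \<Rightarrow> 'k"
    and x :: "nat \<Rightarrow> 'a"
  assumes "normed_space_over sc"
    and "unconditional_atomic_decomposition sc x' x"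
  shows "shrinking sc x' x \<longleftrightarrow> \<not> contains_ell1 sc"
  using contains_ell1_if_not_shrinking[OF assms] not_contains_ell1_if_shrinking[OF assms] by blast

end
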